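(* Let $n\ge2$, let $\widehat{I}\subseteq\Delta_n$ be a closed set with set of covering relations $I$, and let $q=p^m$ be a power of a prime $p$, with $m>1$. Let $\Gamma=\mathcal{U}\mathcal{T}_{\widehat{I}}(n,q)$ and let $F$ be a field automorphism of $\mathbb{F}_q$, acting entrywise on matrices and hence on the elements of $\Gamma$. Then $\Gamma^F\cong\mathcal{U}\mathcal{T}_{\widehat{I}}(n,p)$, where $\Gamma^F$ is the fixed-point incidence system of $F$.
   Context: $\Delta_n=\{(a,b)\in\mathbb{N}^2\mid 1\le a<b\le n\}$. A subset $S\subseteq\Delta_n$ is closed if $(i,j),(j,k)\in S$ implies $(i,k)\in S$. A closed set $\widehat{I}$ defines a strict partial order on $\{1,\dots,n\}$ by $i\prec j$ iff $(i,j)\in\widehat{I}$; its covering relations are $I=\{(i,j)\in\widehat{I}\mid\text{there is no }k\text{ with }i\prec k\prec j\}$. For $(i,j)\in\Delta_n$ and $t$ in a field, $e_{i,j}(t)$ is the $n\times n$ upper unitriangular matrix with $(i,j)$-entry $t$ and all other off-diagonal entries $0$. For a prime power $r$, the pattern group is $UT_{\widehat{I}}(n,\mathbb{F}_r)=\{g\text{ an }n\times n\text{ upper unitriangular matrix over }\mathbb{F}_r\mid g_{i,j}=0\text{ for all }(i,j)\in\Delta_n\setminus\widehat{I}\}$. For $(i,j)\in I$ put $U_{(i,j)}(r)=\langle e_{k,l}(\alpha)\mid\alpha\in\mathbb{F}_r,\ (k,l)\in I\setminus\{(i,j)\}\rangle$. $\mathcal{U}\mathcal{T}_{\widehat{I}}(n,r)$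 denotes the coset incidence system $(UT_{\widehat{I}}(n,\mathbb{F}_r),(U_{(i,j)}(r))_{(i,j)\in I})$: its type set is $I$, its elements of type $(i,j)\in I$ are the left cosets $gU_{(i,j)}(r)$ with $g\in UT_{\widehat{I}}(n,\mathbb{F}_r)$, and two elements are incident iff the cosets have non-empty intersection. If $\Gamma$ is an incidence system with type set $I$ and element sets $X_i$ ($i\in I$), and $\phi$ is a type-preserving automorphism of $\Gamma$ whose set $X_i^\phi$ of fixed points in $X_i$ is nonempty for every $i\in I$, then the fixed-point incidence system $\Gamma^\phi$ of $\phi$ has element set $\bigcup_{i\in I}X_i^\phi$, the same type set $I$, elements of $X_i^\phi$ having type $i$, and two elements incident in $\Gamma^\phi$ iff they are incident in $\Gamma$. Here a coset $gU_{(i,j)}(q)$ is fixed by $F$ when $F(gU_{(i,j)}(q))=gU_{(i,j)}(q)$. Isomorphism $\cong$ of incidence systems means a type-preserving bijection of elements preserving incidence in both directions.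
   Formalization: The field automorphism F is additionally assumed to have fixed field of order p (e.g. Frobenius); for an arbitrary F, such as the identity with n=2 and Î={(1,2)}, the claim is false. *)

theory Defs
  imports
    "HOL-Algebra.Generated_Groups"
    "HOL-Algebra.Coset"
    "HOL-Computational_Algebra.Primes"
    "Jordan_Normal_Form.Determinant"
    "Jordan_Normal_Form.Ring_Hom_Matrix"
begin

section \<open>Incidence systems\<close>

record ('i, 'x) incidence_system =
  types :: "'i set"
  elems :: "'x set"
  type_of :: "'x \<Rightarrow> 'i"
  incident :: "'x \<Rightarrow> 'x \<Rightarrow> bool"

definition is_incidence_system :: "('i, 'x) incidence_system \<Rightarrow> bool" where
  "is_incidence_system \<Gamma> \<longleftrightarrow>
     (\<forall>x\<in>elems \<Gamma>. type_of \<Gamma> x \<in> types \<Gamma>) \<and>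
     (\<forall>x\<in>elems \<Gamma>. incident \<Gamma> x x) \<and>
     (\<forall>x\<in>elems \<Gamma>. \<forall>y\<in>elems \<Gamma>. incident \<Gamma> x y \<longrightarrow> incident \<Gamma> y x) \<and>
     (\<forall>x\<in>elems \<Gamma>. \<forall>y\<in>elems \<Gamma>. type_of \<Gamma> x = type_of \<Gamma> y \<and> incident \<Gamma> x y \<longrightarrow> x = y)"

definition elems_of_type :: "('i, 'x) incidence_system \<Rightarrow> 'i \<Rightarrow> 'x set" where
  "elems_of_type \<Gamma> i = {x \<in> elems \<Gamma>. type_of \<Gamma> x = i}"

definition is_iso ::
    "('i, 'x) incidence_system \<Rightarrow> ('i, 'y) incidence_system \<Rightarrow> ('x \<Rightarrow> 'y) \<Rightarrow> bool" where
  "is_iso \<Gamma> \<Gamma>' f \<longleftrightarrow>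
     types \<Gamma> = types \<Gamma>' \<and>
     bij_betw f (elems \<Gamma>) (elems \<Gamma>') \<and>
     (\<forall>x\<in>elems \<Gamma>. type_of \<Gamma>' (f x) = type_of \<Gamma> x) \<and>
     (\<forall>x\<in>elems \<Gamma>. \<forall>y\<in>elems \<Gamma>. incident \<Gamma>' (f x) (f y) \<longleftrightarrow> incident \<Gamma> x y)"

definition isomorphic ::
    "('i, 'x) incidence_system \<Rightarrow> ('i, 'y) incidence_system \<Rightarrow> bool" where
  "isomorphic \<Gamma> \<Gamma>' \<longleftrightarrow> (\<exists>f. is_iso \<Gamma> \<Gamma>' f)"

definition fixed_point_system ::
    "('i, 'x) incidence_system \<Rightarrow> ('x \<Rightarrow> 'x) \<Rightarrow> ('i, 'x) incidence_system" where
  "fixed_point_system \<Gamma> \<phi> = \<Gamma>\<lparr>elems := {x \<in> elems \<Gamma>. \<phi> x = x}\<rparr>"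

text \<open>An element is a coset tagged with its type, so that the element sets of distinct
  types are disjoint by construction.\<close>

definition coset_incidence_system ::
    "('g, 'b) monoid_scheme \<Rightarrow> 'i set \<Rightarrow> ('i \<Rightarrow> 'g set) \<Rightarrow> ('i, 'i \<times> 'g set) incidence_system"
  where
  "coset_incidence_system G I U =
     \<lparr>types = I,
      elems = {(i, g <#\<^bsub>G\<^esub> U i) |i g. i \<in> I \<and> g \<in> carrier G},
      type_of = fst,
      incident = (\<lambda>(i, C) (j, D). C \<inter> D \<noteq> {})\<rparr>"

section \<open>Pattern groups\<close>

definition \<Delta> :: "nat \<Rightarrow> (nat \<times> nat) set" where
  "\<Delta> n = {(a, b). 1 \<le> a \<and> a < b \<and> b \<le> n}"

text \<open>A subset of \<open>\<Delta> n\<close> is closed iff it is transitive as a relation (\<open>trans\<close>).\<close>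

definition covering_relations :: "(nat \<times> nat) set \<Rightarrow> (nat \<times> nat) set" where
  "covering_relations S = {(i, j) \<in> S. \<not> (\<exists>k. (i, k) \<in> S \<and> (k, j) \<in> S)}"

text \<open>Positions are numbered from \<open>1\<close>, whereas the entries of a matrix are numbered
  from \<open>0\<close>.\<close>

definition entry :: "'a mat \<Rightarrow> nat \<Rightarrow> nat \<Rightarrow> 'a" where
  "entry g i j = g $$ (i - 1, j - 1)"

definition elem_mat :: "nat \<Rightarrow> nat \<Rightarrow> nat \<Rightarrow> 'a::field \<Rightarrow> 'a mat" where
  "elem_mat n i j t =
     mat n n (\<lambda>(k, l). if k = l then 1 else if (k, l) = (i - 1, j - 1) then t else 0)"

definition unitriangular_mats :: "nat \<Rightarrow> 'a::field mat set" where
  "unitriangular_mats n = {g \<in> carrier_mat n n. upper_triangular g \<and> (\<forall>k<n. g $$ (k, k) = 1)}"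

definition pattern_group :: "nat \<Rightarrow> (nat \<times> nat) set \<Rightarrow> 'a::field mat monoid" where
  "pattern_group n S =
     \<lparr>carrier = {g \<in> unitriangular_mats n. \<forall>(i, j) \<in> \<Delta> n - S. entry g i j = 0},
      monoid.mult = (*),
      one = 1\<^sub>m n\<rparr>"

definition pattern_subgroup ::
    "nat \<Rightarrow> (nat \<times> nat) set \<Rightarrow> nat \<times> nat \<Rightarrow> 'a::field mat set" where
  "pattern_subgroup n S ij =
     generate (pattern_group n S)
       {elem_mat n k l \<alpha> |k l \<alpha>. (k, l) \<in> covering_relations S - {ij}}"

definition pattern_coset_system ::
    "nat \<Rightarrow> (nat \<times> nat) set \<Rightarrow> (nat \<times> nat, (nat \<times> nat) \<times> 'a::field mat set) incidence_system"
  where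
  "pattern_coset_system n S =
     coset_incidence_system (pattern_group n S) (covering_relations S) (pattern_subgroup n S)"

definition field_action :: "('a \<Rightarrow> 'a) \<Rightarrow> 'i \<times> 'a mat set \<Rightarrow> 'i \<times> 'a mat set" where
  "field_action F = (\<lambda>(i, C). (i, map_mat F ` C))"

section \<open>Well-definedness of the coset systems and of the action of \<open>F\<close>\<close>

lemma finite_carrier_mat: "finite (carrier_mat n n :: 'a::finite mat set)"
proof -
  have "carrier_mat n n \<subseteq> (\<lambda>f. mat n n f) ` (({..<n} \<times> {..<n}) \<rightarrow>\<^sub>E (UNIV :: 'a set))"
  proof
    fix A :: "'a mat" assume A: "A \<in> carrier_mat n n"
    have "A = mat n n (restrict (($$) A) ({..<n} \<times> {..<n}))"
      using A by (intro eq_matI) auto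
    moreover have "restrict (($$) A) ({..<n} \<times> {..<n}) \<in> ({..<n} \<times> {..<n}) \<rightarrow>\<^sub>E UNIV"
      by auto
    ultimately show "A \<in> (\<lambda>f. mat n n f) ` (({..<n} \<times> {..<n}) \<rightarrow>\<^sub>E (UNIV :: 'a set))"
      by blast
  qed
  then show ?thesis
    by (rule finite_subset) (intro finite_imageI finite_PiE; simp)
qed

lemma pattern_group_carrier_iff:
  "g \<in> carrier (pattern_group n S) \<longleftrightarrow>
     g \<in> carrier_mat n n \<and> (\<forall>a<n. g $$ (a, a) = 1) \<and> (\<forall>a<n. \<forall>b<a. g $$ (a, b) = 0) \<and>
     (\<forall>a<n. \<forall>b<n. a < b \<longrightarrow> (Suc a, Suc b) \<notin> S \<longrightarrow> g $$ (a, b) = 0)"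
  (is "?L \<longleftrightarrow> ?R")
proof
  assume L: ?L
  then have g: "g \<in> carrier_mat n n" "upper_triangular g" "\<forall>a<n. g $$ (a, a) = 1"
    and e: "\<forall>(i, j) \<in> \<Delta> n - S. entry g i j = 0"
    by (auto simp: pattern_group_def unitriangular_mats_def)
  have "g $$ (a, b) = 0" if "a < n" "b < n" "a < b" "(Suc a, Suc b) \<notin> S" for a b
  proof -
    have "(Suc a, Suc b) \<in> \<Delta> n - S" using that by (auto simp: \<Delta>_def)
    then have "entry g (Suc a) (Suc b) = 0" using e by blast
    then show ?thesis by (simp add: entry_def)
  qed
  then show ?R using g by auto
next
  assume R: ?R
  have "entry g i j = 0" if "(i, j) \<in> \<Delta> n - S" for i j
  proof -
    have "i - 1 < n" "j - 1 < n" "i - 1 < j - 1" "(Suc (i - 1), Suc (j - 1)) \<notin> S"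
      using that by (auto simp: \<Delta>_def)
    then show ?thesis using R unfolding entry_def by blast
  qed
  then show ?L using R by (auto simp: pattern_group_def unitriangular_mats_def)
qed

lemma pattern_group_mult_closed:
  assumes "trans S"
    and g: "g \<in> carrier (pattern_group n S)" and h: "h \<in> carrier (pattern_group n S)"
  shows "g * h \<in> carrier (pattern_group n S)"
proof -
  have gm: "g \<in> carrier_mat n n" and hm: "h \<in> carrier_mat n n"
    using g h by (auto simp: pattern_group_carrier_iff)
  have idx: "(g * h) $$ (a, b) = (\<Sum>c<n. g $$ (a, c) * h $$ (c, b))" if "a < n" "b < n" for a b
    using that gm hm by (simp add: scalar_prod_def lessThan_atLeast0)
  have lo: "x $$ (a, b) = 0" if "x \<in> carrier (pattern_group n S)" "b < a" "a < n" for x a b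
    using that by (auto simp: pattern_group_carrier_iff)
  have up: "x $$ (a, b) = 0"
    if "x \<in> carrier (pattern_group n S)" "a < b" "b < n" "(Suc a, Suc b) \<notin> S" for x a b
    using that by (auto simp: pattern_group_carrier_iff)
  have diag: "(g * h) $$ (a, a) = 1" if "a < n" for a
  proof -
    have "(g * h) $$ (a, a) = (\<Sum>c<n. if c = a then 1 else 0)"
      unfolding idx[OF that that]
    proof (rule sum.cong[OF refl])
      fix c assume "c \<in> {..<n}"
      then show "g $$ (a, c) * h $$ (c, a) = (if c = a then 1 else 0)"
        using lo[OF g, of c a] lo[OF h, of a c] that g h
        by (cases c a rule: linorder_cases) (auto simp: pattern_group_carrier_iff)
    qed
    then show ?thesis using that by simp
  qed
  have low: "(g * h) $$ (a, b) = 0" if "a < n" "b < a" for a b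
    unfolding idx[OF that(1) less_trans[OF that(2,1)]]
  proof (rule sum.neutral, rule)
    fix c assume "c \<in> {..<n}"
    then show "g $$ (a, c) * h $$ (c, b) = 0"
      using lo[OF g, of c a] lo[OF h, of b c] that by (cases "c < a") auto
  qed
  have upp: "(g * h) $$ (a, b) = 0" if "a < n" "b < n" "a < b" "(Suc a, Suc b) \<notin> S" for a b
    unfolding idx[OF that(1,2)]
  proof (rule sum.neutral, rule)
    fix c assume c: "c \<in> {..<n}"
    consider "c < a" | "c = a" | "a < c" "c < b" | "c = b" | "b < c"
      using that by linarith
    then show "g $$ (a, c) * h $$ (c, b) = 0"
    proof cases
      case 3
      have "(Suc a, Suc c) \<notin> S \<or> (Suc c, Suc b) \<notin> S"
        using \<open>trans S\<close> that(4) by (meson transD)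
      then show ?thesis using up[OF g, of a c] up[OF h, of c b] 3 c that by auto
    qed (use lo[OF g, of c a] lo[OF h, of b c] up[OF g, of a b] up[OF h, of a b] c that in auto)
  qed
  show ?thesis
    using gm hm diag low upp by (auto simp: pattern_group_carrier_iff simp del: index_mult_mat(1))
qed

lemma group_pattern_group:
  assumes "trans S"
  shows "group (pattern_group n S :: 'a::{field, finite} mat monoid)" (is "group ?G")
proof -
  have sub: "carrier ?G \<subseteq> carrier_mat n n"
    by (auto simp: pattern_group_carrier_iff)
  have mul: "x \<otimes>\<^bsub>?G\<^esub> y = x * y" and one: "\<one>\<^bsub>?G\<^esub> = 1\<^sub>m n" for x y
    by (auto simp: pattern_group_def)
  have one_in: "1\<^sub>m n \<in> carrier ?G"
    by (auto simp: pattern_group_carrier_iff)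
  have right_inv: "\<exists>y\<in>carrier ?G. x * y = 1\<^sub>m n" if x: "x \<in> carrier ?G" for x
  proof -
    have xm: "x \<in> carrier_mat n n" using x sub by blast
    have "upper_triangular x" using x by (auto simp: pattern_group_def unitriangular_mats_def)
    then have "det x = prod_list (diag_mat x)" using det_upper_triangular xm by blast
    also have "diag_mat x = replicate n 1"
      using x xm by (auto simp: diag_mat_def pattern_group_carrier_iff intro!: nth_equalityI)
    finally have "det x \<noteq> 0" by simp
    from det_non_zero_imp_unit[OF xm this, of "()"] obtain z
      where z: "z \<in> carrier_mat n n" "z * x = 1\<^sub>m n"
      by (auto simp: Units_def ring_mat_def)
    have "inj_on ((*) x) (carrier ?G)"
    proof (rule inj_onI)
      fix u v assume u: "u \<in> carrier ?G" and v: "v \<in> carrier ?G" and e: "x * u = x * v"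
      have um: "u \<in> carrier_mat n n" and vm: "v \<in> carrier_mat n n" using u v sub by auto
      have "u = (z * x) * u" using z um by simp
      also have "\<dots> = z * (x * u)" by (rule assoc_mult_mat[OF z(1) xm um])
      also have "\<dots> = (z * x) * v" unfolding e by (rule assoc_mult_mat[OF z(1) xm vm, symmetric])
      finally show "u = v" using z vm by simp
    qed
    moreover have "finite (carrier ?G)" using finite_subset[OF sub finite_carrier_mat] .
    moreover have "(*) x ` carrier ?G \<subseteq> carrier ?G"
      using pattern_group_mult_closed[OF assms x] by auto
    ultimately have "(*) x ` carrier ?G = carrier ?G"
      by (metis endo_inj_surj)
    then show ?thesis using one_in by (metis imageE)
  qed
  have assoc: "(x * y) * z = x * (y * z)"
    if "x \<in> carrier ?G" "y \<in> carrier ?G" "z \<in> carrier ?G" for x y z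
    using that sub by (meson assoc_mult_mat subsetD)
  have left_one: "1\<^sub>m n * x = x" "x * 1\<^sub>m n = x" if "x \<in> carrier ?G" for x
    using that sub by auto
  show ?thesis
  proof (rule groupI)
    fix x assume x: "x \<in> carrier ?G"
    obtain y where y: "y \<in> carrier ?G" "x * y = 1\<^sub>m n" using right_inv[OF x] by blast
    obtain z where z: "z \<in> carrier ?G" "y * z = 1\<^sub>m n" using right_inv[OF y(1)] by blast
    have "x = x * (y * z)" using z left_one x by simp
    also have "\<dots> = z" unfolding assoc[OF x y(1) z(1), symmetric] y(2) using left_one z by simp
    finally show "\<exists>y\<in>carrier ?G. y \<otimes>\<^bsub>?G\<^esub> x = \<one>\<^bsub>?G\<^esub>"
      using y z by (auto simp: mul one)
  qed (auto simp: mul one one_in left_one assoc pattern_group_mult_closed[OF assms])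
qed

lemma elem_mat_in_carrier:
  assumes "S \<subseteq> \<Delta> n" "(k, l) \<in> S"
  shows "elem_mat n k l \<alpha> \<in> carrier (pattern_group n S)"
proof -
  have "1 \<le> k" "k < l" "l \<le> n" using assms by (auto simp: \<Delta>_def)
  then show ?thesis using assms
    by (auto simp: pattern_group_carrier_iff elem_mat_def)
qed

lemma subgroup_pattern_subgroup:
  assumes "S \<subseteq> \<Delta> n" "trans S"
  shows "subgroup (pattern_subgroup n S ij) (pattern_group n S :: 'a::{field, finite} mat monoid)"
  unfolding pattern_subgroup_def
  by (rule group.generate_is_subgroup[OF group_pattern_group[OF assms(2)]])
     (use elem_mat_in_carrier[OF assms(1)] in \<open>auto simp: covering_relations_def\<close>)

lemma is_incidence_system_coset_incidence_system:
  assumes "group G" "\<And>i. i \<in> I \<Longrightarrow> subgroup (U i) G"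
  shows "is_incidence_system (coset_incidence_system G I U)"
proof -
  have self: "g \<in> g <#\<^bsub>G\<^esub> U i" if "i \<in> I" "g \<in> carrier G" for i g
  proof -
    have "\<one>\<^bsub>G\<^esub> \<in> U i" using assms(2)[OF that(1)] by (rule subgroup.one_closed)
    moreover have "g = g \<otimes>\<^bsub>G\<^esub> \<one>\<^bsub>G\<^esub>"
      using monoid.r_one[OF group.is_monoid[OF assms(1)] that(2)] by simp
    ultimately show ?thesis unfolding l_coset_def by blast
  qed
  have disj: "g <#\<^bsub>G\<^esub> U i = h <#\<^bsub>G\<^esub> U i"
    if i: "i \<in> I" and g: "g \<in> carrier G" and h: "h \<in> carrier G"
      and ne: "(g <#\<^bsub>G\<^esub> U i) \<inter> (h <#\<^bsub>G\<^esub> U i) \<noteq> {}" for i g h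
  proof -
    obtain x where x: "x \<in> g <#\<^bsub>G\<^esub> U i" "x \<in> h <#\<^bsub>G\<^esub> U i" using ne by blast
    show ?thesis
      using group.l_repr_independence[OF assms(1) x(1) g assms(2)[OF i]]
            group.l_repr_independence[OF assms(1) x(2) h assms(2)[OF i]] by simp
  qed
  show ?thesis
    unfolding is_incidence_system_def coset_incidence_system_def
    using self disj by (fastforce simp: Int_commute)
qed

lemma is_incidence_system_pattern_coset_system:
  assumes "S \<subseteq> \<Delta> n" "trans S"
  shows "is_incidence_system
    (pattern_coset_system n S ::
       (nat \<times> nat, (nat \<times> nat) \<times> 'a::{field, finite} mat set) incidence_system)"
  unfolding pattern_coset_system_def
  by (intro is_incidence_system_coset_incidence_system group_pattern_group
      subgroup_pattern_subgroup assms)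

context
  fixes F :: "'a::{field, finite} \<Rightarrow> 'a" and n :: nat and S :: "(nat \<times> nat) set"
  assumes F: "field_isom F" and S: "S \<subseteq> \<Delta> n" "trans S"
begin

interpretation field_isom F by (rule F)

lemma map_mat_hom: "map_mat F \<in> hom (pattern_group n S) (pattern_group n S)"
proof (rule homI)
  fix x y :: "'a mat"
  assume x: "x \<in> carrier (pattern_group n S)"
  then show "map_mat F x \<in> carrier (pattern_group n S)"
    by (auto simp: pattern_group_carrier_iff)
  assume "y \<in> carrier (pattern_group n S)"
  with x have "x \<in> carrier_mat n n" "y \<in> carrier_mat n n"
    by (auto simp: pattern_group_carrier_iff)
  then show "map_mat F (x \<otimes>\<^bsub>pattern_group n S\<^esub> y) =
    map_mat F x \<otimes>\<^bsub>pattern_group n S\<^esub> map_mat F y"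
    by (simp add: pattern_group_def mat_hom_mult)
qed

lemma inj_map_mat: "inj (map_mat F)"
  by (rule injI) (rule mat_hom_inj)

lemma map_mat_carrier:
  "map_mat F ` carrier (pattern_group n S) = carrier (pattern_group n S)"
proof (rule endo_inj_surj)
  show "finite (carrier (pattern_group n S :: 'a mat monoid))"
    by (rule finite_subset[OF _ finite_carrier_mat[of n]]) (auto simp: pattern_group_carrier_iff)
  show "map_mat F ` carrier (pattern_group n S) \<subseteq> carrier (pattern_group n S)"
    using map_mat_hom by (auto simp: hom_def)
  show "inj_on (map_mat F) (carrier (pattern_group n S))"
    using inj_map_mat by (rule inj_on_subset) simp
qed

lemma map_mat_pattern_subgroup:
  "map_mat F ` pattern_subgroup n S ij = pattern_subgroup n S ij"
proof -
  let ?G = "pattern_group n S :: 'a mat monoid"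
  let ?E = "{elem_mat n k l \<alpha> |k l (\<alpha> :: 'a). (k, l) \<in> covering_relations S - {ij}}"
  have gh: "group_hom ?G ?G (map_mat F)"
    using group_pattern_group[OF S(2)] map_mat_hom
    by (auto simp: group_hom_def group_hom_axioms_def)
  have E: "?E \<subseteq> carrier ?G"
    using elem_mat_in_carrier[OF S(1)] by (auto simp: covering_relations_def)
  have el: "map_mat F (elem_mat n k l \<alpha>) = elem_mat n k l (F \<alpha>)" for k l \<alpha>
    by (rule eq_matI) (auto simp: elem_mat_def)
  have "map_mat F ` ?E = ?E"
  proof
    show "map_mat F ` ?E \<subseteq> ?E" using el by blast
    show "?E \<subseteq> map_mat F ` ?E"
    proof
      fix x assume "x \<in> ?E"
      then obtain k l \<alpha> where x: "x = elem_mat n k l \<alpha>" "(k, l) \<in> covering_relations S - {ij}"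
        by blast
      obtain \<beta> where "\<alpha> = F \<beta>" using surj by (metis surjD)
      then have "x = map_mat F (elem_mat n k l \<beta>)" using x el by simp
      then show "x \<in> map_mat F ` ?E" using x(2) by blast
    qed
  qed
  then show ?thesis
    unfolding pattern_subgroup_def
    using group_hom.generate_img[OF gh E] by simp
qed

lemma map_mat_coset:
  assumes "g \<in> carrier (pattern_group n S)"
  shows "map_mat F ` (g <#\<^bsub>pattern_group n S\<^esub> pattern_subgroup n S ij) =
    map_mat F g <#\<^bsub>pattern_group n S\<^esub> pattern_subgroup n S ij"
proof -
  let ?G = "pattern_group n S :: 'a mat monoid"
  have U: "pattern_subgroup n S ij \<subseteq> carrier ?G"
    using subgroup_pattern_subgroup[OF S] by (rule subgroup.subset)
  have "map_mat F ` (g <#\<^bsub>?G\<^esub> pattern_subgroup n S ij) =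
    (\<lambda>u. map_mat F (g \<otimes>\<^bsub>?G\<^esub> u)) ` pattern_subgroup n S ij"
    by (auto simp: l_coset_def)
  also have "\<dots> = (\<lambda>u. map_mat F g \<otimes>\<^bsub>?G\<^esub> map_mat F u) ` pattern_subgroup n S ij"
    using U assms map_mat_hom by (intro image_cong refl) (auto simp: hom_def)
  also have "\<dots> = map_mat F g <#\<^bsub>?G\<^esub> (map_mat F ` pattern_subgroup n S ij)"
    by (auto simp: l_coset_def)
  finally show ?thesis by (simp add: map_mat_pattern_subgroup)
qed

lemma field_action_automorphism:
  "is_iso (pattern_coset_system n S) (pattern_coset_system n S) (field_action F)"
proof -
  let ?G = "pattern_group n S :: 'a mat monoid"
  let ?X = "elems (pattern_coset_system n S ::
    (nat \<times> nat, (nat \<times> nat) \<times> 'a mat set) incidence_system)"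
  have X: "?X = {(i, g <#\<^bsub>?G\<^esub> pattern_subgroup n S i) |i g.
      i \<in> covering_relations S \<and> g \<in> carrier ?G}"
    by (simp add: pattern_coset_system_def coset_incidence_system_def)
  have img: "map_mat F ` C = map_mat F ` D \<longleftrightarrow> C = D" for C D
    using inj_map_mat by (rule inj_image_eq_iff)
  have "field_action F ` ?X = ?X"
  proof
    show "field_action F ` ?X \<subseteq> ?X"
      unfolding X field_action_def using map_mat_coset map_mat_carrier by fastforce
    show "?X \<subseteq> field_action F ` ?X"
    proof
      fix x assume "x \<in> ?X"
      then obtain i g where x: "x = (i, g <#\<^bsub>?G\<^esub> pattern_subgroup n S i)"
          "i \<in> covering_relations S" "g \<in> carrier ?G"
        unfolding X by blast
      obtain h where h: "h \<in> carrier ?G" "g = map_mat F h"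
        using x(3) map_mat_carrier by blast
      have "x = field_action F (i, h <#\<^bsub>?G\<^esub> pattern_subgroup n S i)"
        using x(1) h map_mat_coset by (simp add: field_action_def)
      moreover have "(i, h <#\<^bsub>?G\<^esub> pattern_subgroup n S i) \<in> ?X"
        unfolding X using x(2) h(1) by blast
      ultimately show "x \<in> field_action F ` ?X" by blast
    qed
  qed
  moreover have "inj_on (field_action F) ?X"
    by (auto simp: inj_on_def field_action_def img)
  moreover have "map_mat F ` C \<inter> map_mat F ` D = {} \<longleftrightarrow> C \<inter> D = {}" for C D
    using image_Int[OF inj_map_mat, of C D] by (metis image_is_empty)
  ultimately show ?thesis
    by (auto simp: is_iso_def bij_betw_def pattern_coset_system_def coset_incidence_system_def
        field_action_def)
qed

lemma fixed_point_of_each_type: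
  assumes "i \<in> covering_relations S"
  shows "elems_of_type
    (fixed_point_system (pattern_coset_system n S) (field_action F)) i \<noteq> {}"
proof -
  let ?G = "pattern_group n S :: 'a mat monoid"
  have one: "\<one>\<^bsub>?G\<^esub> \<in> carrier ?G"
    using group.is_monoid[OF group_pattern_group[OF S(2)]] by (rule monoid.one_closed)
  have "map_mat F \<one>\<^bsub>?G\<^esub> = \<one>\<^bsub>?G\<^esub>" by (simp add: pattern_group_def mat_hom_one)
  then have "(i, \<one>\<^bsub>?G\<^esub> <#\<^bsub>?G\<^esub> pattern_subgroup n S i) \<in> elems_of_type
    (fixed_point_system (pattern_coset_system n S) (field_action F)) i"
    using assms one map_mat_coset[OF one]
    by (cases i) (auto simp: elems_of_type_def fixed_point_system_def pattern_coset_system_def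
        coset_incidence_system_def field_action_def)
  then show ?thesis by blast
qed

end

end

theory Submission
  imports Defs "HOL-Number_Theory.Residues"
begin

text \<open>
  The fixed field of \<open>F\<close> has \<open>p\<close> elements, so it is the image of an embedding \<open>\<sigma>\<close> of \<open>\<bbbF>\<^sub>p\<close>
  (\<open>prime_field_embedding_onto_fixed_field\<close>), and the matrices fixed by \<open>F\<close>
  are exactly the images under \<open>\<sigma>\<close> of matrices over \<open>\<bbbF>\<^sub>p\<close>. The isomorphism sends a fixed coset \<open>C\<close> to its set \<open>\<sigma>\<inverse>(C)\<close> of rational
  points, with \<open>\<sigma>\<close> applied entrywise. Three facts make this work.

  First, the subgroups \<open>U\<^bsub>(i,j)\<^esub>\<close> are themselves pattern groups, for the transitive closure of
  \<open>I - {(i,j)}\<close> (\<open>pattern_subgroup_eq\<close>): commutators of elementary matrices supply the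
  elementary matrices at all positions of the closure, and these generate the pattern group. So
  membership in \<open>U\<^bsub>(i,j)\<^esub>\<close> is a condition on the zero entries of a matrix, which \<open>\<sigma>\<close> preserves and
  reflects. Intersections \<open>U\<^bsub>(i,j)\<^esub> \<inter> U\<^bsub>(k,l)\<^esub>\<close> are pattern groups too, because intersections of
  transitive relations are transitive.

  Secondly, if \<open>T \<subseteq> S\<close> are closed, every coset \<open>g UT\<^sub>T\<close> in \<open>UT\<^sub>S\<close> contains exactly one matrix
  that vanishes at all positions of \<open>T\<close>: column operations produce one (\<open>clear_entries\<close>), and
  two of them cannot differ by a nontrivial element of \<open>UT\<^sub>T\<close> (\<open>vanishing_multiplier_eq_one\<close>).
  Since \<open>F\<close> preserves the vanishing of entries, it fixes this representative whenever it maps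
  the coset to itself (\<open>stable_coset_has_fixed_point\<close>). This elementary argument takes the place
  of the vanishing of the Galois cohomology of \<open>UT\<^sub>T\<close>.

  Hence a fixed coset \<open>g U\<^bsub>(i,j)\<^esub>(q)\<close> has a rational representative \<open>\<sigma>(y)\<close>, its rational points
  form the coset \<open>y U\<^bsub>(i,j)\<^esub>(p)\<close>, and the correspondence is bijective. Finally, two incident
  fixed cosets meet in a coset of an intersection \<open>U\<^bsub>(i,j)\<^esub> \<inter> U\<^bsub>(k,l)\<^esub>\<close>; this coset is again
  stable under \<open>F\<close>, so it contains a rational point and the images are incident as well.
\<close>

section \<open>Elementary matrices\<close>

lemma pattern_group_simps [simp]:
  "x \<otimes>\<^bsub>pattern_group n S\<^esub> y = x * y" "\<one>\<^bsub>pattern_group n S\<^esub> = 1\<^sub>m n"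
  by (simp_all add: pattern_group_def)

lemma elem_mat_carrier_mat: "elem_mat n k l t \<in> carrier_mat n n"
  by (simp add: elem_mat_def)

lemma pattern_group_carrier_mat: "g \<in> carrier (pattern_group n S) \<Longrightarrow> g \<in> carrier_mat n n"
  by (simp add: pattern_group_carrier_iff)

lemma index_mult_elem_mat:
  fixes x :: "'a::field mat"
  assumes x: "x \<in> carrier_mat n n" and kl: "(k, l) \<in> \<Delta> n" and r: "r < n" and s: "s < n"
  shows "(x * elem_mat n k l t) $$ (r, s) =
    x $$ (r, s) + (if s = l - 1 then x $$ (r, k - 1) * t else 0)"
proof -
  have kl': "k - 1 < n" "l - 1 < n" "k - 1 \<noteq> l - 1" using kl by (auto simp: \<Delta>_def)
  have "(x * elem_mat n k l t) $$ (r, s) = (\<Sum>c<n. x $$ (r, c) * elem_mat n k l t $$ (c, s))"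
    using x r s elem_mat_carrier_mat[of n k l t] by (simp add: scalar_prod_def lessThan_atLeast0)
  also have "\<dots> = (\<Sum>c<n. (if c = s then x $$ (r, s) else 0) +
      (if c = k - 1 then if s = l - 1 then x $$ (r, k - 1) * t else 0 else 0))"
    by (rule sum.cong) (use s kl' in \<open>auto simp: elem_mat_def\<close>)
  also have "\<dots> = x $$ (r, s) + (if s = l - 1 then x $$ (r, k - 1) * t else 0)"
    using s kl' by (simp add: sum.distrib)
  finally show ?thesis .
qed

lemma elem_mat_commutator:
  fixes s t :: "'a::field"
  assumes ij: "(i, j) \<in> \<Delta> n" and jk: "(j, k) \<in> \<Delta> n"
  shows "elem_mat n i j s * elem_mat n j k t * elem_mat n i j (- s) * elem_mat n j k (- t) =
    elem_mat n i k (s * t)"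
proof -
  have ne: "i - 1 < j - 1" "j - 1 < k - 1" "k - 1 < n" using ij jk by (auto simp: \<Delta>_def)
  note car = elem_mat_carrier_mat mult_carrier_mat[OF _ elem_mat_carrier_mat]
  show ?thesis
  proof (rule eq_matI)
    fix r c assume "r < dim_row (elem_mat n i k (s * t))" "c < dim_col (elem_mat n i k (s * t))"
    then have rc: "r < n" "c < n" by (auto simp: elem_mat_def)
    have lt: "i - 1 < n" "j - 1 < n" "k - 1 < n" using ne by auto
    have ent: "elem_mat n a b u $$ (r, d) =
        (if r = d then 1 else if (r, d) = (a - 1, b - 1) then u else 0)" if "d < n" for a b u d
      using rc that by (simp add: elem_mat_def)
    show "(elem_mat n i j s * elem_mat n j k t * elem_mat n i j (- s) * elem_mat n j k (- t))
        $$ (r, c) = elem_mat n i k (s * t) $$ (r, c)"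
      unfolding index_mult_elem_mat[OF car(2)[OF car(2)[OF car(1)]] jk rc]
        index_mult_elem_mat[OF car(2)[OF car(1)] ij rc(1) rc(2)]
        index_mult_elem_mat[OF car(2)[OF car(1)] ij rc(1) lt(2)]
        index_mult_elem_mat[OF car(1) jk rc(1) rc(2)]
        index_mult_elem_mat[OF car(1) jk rc(1) lt(1)]
        index_mult_elem_mat[OF car(1) jk rc(1) lt(2)]
        ent[OF rc(2)] ent[OF lt(1)] ent[OF lt(2)]
      using ne by auto
  qed (auto simp: elem_mat_def)
qed

section \<open>Pattern groups inside pattern groups\<close>

lemma pattern_group_carrier_mono:
  "T \<subseteq> S \<Longrightarrow> carrier (pattern_group n T) \<subseteq> carrier (pattern_group n S)"
  unfolding subset_iff pattern_group_carrier_iff by blast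

lemma pattern_group_carrier_Int:
  "carrier (pattern_group n T) \<inter> carrier (pattern_group n T') =
    carrier (pattern_group n (T \<inter> T'))"
  by (auto simp: pattern_group_carrier_iff)

lemma subgroup_pattern_group:
  assumes "trans S" "trans T" "T \<subseteq> S"
  shows "subgroup (carrier (pattern_group n T))
    (pattern_group n S :: 'a::{field, finite} mat monoid)"
proof -
  let ?S = "pattern_group n S :: 'a mat monoid" and ?T = "pattern_group n T :: 'a mat monoid"
  interpret GS: group ?S by (rule group_pattern_group[OF assms(1)])
  interpret GT: group ?T by (rule group_pattern_group[OF assms(2)])
  have sub: "carrier ?T \<subseteq> carrier ?S" by (rule pattern_group_carrier_mono[OF assms(3)])
  show ?thesis
  proof (rule GS.subgroupI)
    show "carrier ?T \<noteq> {}" using GT.one_closed by blast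
    fix x assume x: "x \<in> carrier ?T"
    have "inv\<^bsub>?S\<^esub> x = inv\<^bsub>?T\<^esub> x"
      using GT.l_inv[OF x] GT.inv_closed[OF x] x sub by (intro GS.inv_equality) auto
    then show "inv\<^bsub>?S\<^esub> x \<in> carrier ?T" using GT.inv_closed[OF x] by simp
    fix y assume "y \<in> carrier ?T"
    then show "x \<otimes>\<^bsub>?S\<^esub> y \<in> carrier ?T" using GT.m_closed[OF x] by simp
  qed (rule sub)
qed

lemma (in group) l_coset_self:
  assumes "x \<in> carrier G" "subgroup H G"
  shows "x \<in> x <# H"
  unfolding l_coset_def using subgroup.one_closed[OF assms(2)] r_one[OF assms(1)] by force

text \<open>
  Gaussian elimination by columns. Multiplication by \<open>elem_mat n a c t\<close> on the right adds a
  multiple of column \<open>a\<close>, whose lowest nonzero entry is the \<open>1\<close> in row \<open>a\<close>, to column \<open>c\<close>. It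
  can therefore clear position \<open>(a, c)\<close> without disturbing the rows below. If the rows are
  treated from the bottom to the top, no cleared position is spoilt again.
\<close>

lemma clear_entries:
  fixes x :: "'a::{field, finite} mat"
  assumes S: "S \<subseteq> \<Delta> n" "trans S" and T: "T \<subseteq> S"
    and H: "subgroup H (pattern_group n S)"
    and elem: "\<And>a c t. (a, c) \<in> T \<Longrightarrow> elem_mat n a c t \<in> H"
    and x: "x \<in> carrier (pattern_group n S)"
  obtains h where "h \<in> H" "\<And>a c. (a, c) \<in> T \<Longrightarrow> (x * h) $$ (a - 1, c - 1) = 0"
proof -
  have "finite (\<Delta> n)" by (rule finite_subset[of _ "{..n} \<times> {..n}"]) (auto simp: \<Delta>_def)
  then have "finite T" using S(1) T by (meson finite_subset)
  have HS: "H \<subseteq> carrier (pattern_group n S)" using H by (rule subgroup.subset)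
  have "D \<subseteq> T \<Longrightarrow> \<exists>h\<in>H. \<forall>(a, c)\<in>D. (x * h) $$ (a - 1, c - 1) = 0" if "finite D" for D
    using that
  proof (induction D rule: finite_ranking_induct[where f = "\<lambda>(a, c). n - a"])
    case empty
    then show ?case using subgroup.one_closed[OF H] by auto
  next
    case (insert ac D)
    \<comment> \<open>The ranking makes \<open>a\<close> the topmost row so far.\<close>
    obtain a c where ac: "ac = (a, c)" by fastforce
    from insert obtain h where h: "h \<in> H"
      and cleared: "\<forall>(a, c)\<in>D. (x * h) $$ (a - 1, c - 1) = 0" by auto
    have acT: "(a, c) \<in> T" and DT: "D \<subseteq> T" using insert.prems ac by auto
    have acn: "(a, c) \<in> \<Delta> n" using acT S T by blast
    define y where "y = x * h"
    have y: "y \<in> carrier (pattern_group n S)"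
      unfolding y_def using pattern_group_mult_closed[OF S(2) x] h HS by blast
    define e where "e = elem_mat n a c (- y $$ (a - 1, c - 1))"
    have he: "h * e \<in> H"
      using subgroup.m_closed[OF H h elem[OF acT]] unfolding e_def by simp
    have xhe: "x * (h * e) = y * e"
      unfolding y_def e_def
      using assoc_mult_mat[OF pattern_group_carrier_mat[OF x] pattern_group_carrier_mat
          elem_mat_carrier_mat] h HS by (metis subsetD)
    have "(y * e) $$ (r - 1, s - 1) = 0" if rs: "(r, s) \<in> insert (a, c) D" for r s
    proof -
      have "(r, s) \<in> \<Delta> n" using rs acT DT S T by blast
      then have rn: "r - 1 < n" "s - 1 < n" "1 \<le> r" "1 \<le> s" "r \<le> n" by (auto simp: \<Delta>_def)
      have an: "a - 1 < n" "c - 1 < n" "1 \<le> a" "1 \<le> c" "a \<le> n" using acn by (auto simp: \<Delta>_def)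
      have step: "(y * e) $$ (r - 1, s - 1) = y $$ (r - 1, s - 1) +
          (if s - 1 = c - 1 then y $$ (r - 1, a - 1) * - y $$ (a - 1, c - 1) else 0)"
        unfolding e_def
        by (rule index_mult_elem_mat[OF pattern_group_carrier_mat[OF y] acn rn(1,2)])
      show ?thesis
      proof (cases "(r, s) = (a, c)")
        case True
        then show ?thesis using step y an by (auto simp: pattern_group_carrier_iff)
      next
        case False
        then have rsD: "(r, s) \<in> D" using rs by auto
        then have ra: "a \<le> r" using insert.hyps(2)[OF rsD] rn an by (auto simp: ac)
        have old: "y $$ (r - 1, s - 1) = 0" using cleared rsD by (auto simp: y_def)
        show ?thesis
        proof (cases "s = c")
          case True
          with False ra rn an have "a - 1 < r - 1" by auto
          then have "y $$ (r - 1, a - 1) = 0"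
            using y rn(1) by (simp add: pattern_group_carrier_iff)
          then show ?thesis using step old by simp
        next
          case False
          then show ?thesis using step old rn an by auto
        qed
      qed
    qed
    then show ?case using he xhe ac by (intro bexI[of _ "h * e"]) auto
  qed
  from this[OF \<open>finite T\<close> subset_refl] show ?thesis using that by auto
qed

text \<open>
  Let \<open>(a, b)\<close> be a lowest position in which \<open>u\<close> differs from the identity. It lies in \<open>T\<close>, and
  \<open>(x * u)\<^bsub>ab\<^esub> = u\<^bsub>ab\<^esub> + x\<^bsub>ab\<^esub>\<close>, where both \<open>x\<close> and \<open>x * u\<close> vanish at that position. So
  \<open>u\<^bsub>ab\<^esub> = 0\<close>, a contradiction.
\<close>

lemma vanishing_multiplier_eq_one:
  fixes x u :: "'a::field mat"
  assumes x: "x \<in> carrier (pattern_group n S)" and u: "u \<in> carrier (pattern_group n T)"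
    and T: "T \<subseteq> \<Delta> n"
    and x0: "\<And>a c. (a, c) \<in> T \<Longrightarrow> x $$ (a - 1, c - 1) = 0"
    and xu0: "\<And>a c. (a, c) \<in> T \<Longrightarrow> (x * u) $$ (a - 1, c - 1) = 0"
  shows "u = 1\<^sub>m n"
proof -
  have "u $$ (a, b) = 0" if "a < b" "b < n" for a b
    using that
  proof (induction "n - a" arbitrary: a rule: less_induct)
    case less
    show ?case
    proof (cases "(Suc a, Suc b) \<in> T")
      case False
      then show ?thesis using u less.prems by (simp add: pattern_group_carrier_iff)
    next
      case True
      have "0 = (x * u) $$ (a, b)" using xu0[OF True] by simp
      also have "\<dots> = (\<Sum>c<n. x $$ (a, c) * u $$ (c, b))"
        using pattern_group_carrier_mat[OF x] pattern_group_carrier_mat[OF u] less.prems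
        by (simp add: scalar_prod_def lessThan_atLeast0)
      also have "\<dots> = (\<Sum>c<n. if c = a then u $$ (a, b) else 0)"
      proof (rule sum.cong[OF refl])
        fix c assume "c \<in> {..<n}"
        then have c: "c < n" by simp
        consider "c < a" | "c = a" | "a < c" "c < b" | "c = b" | "b < c"
          using less.prems by linarith
        then show "x $$ (a, c) * u $$ (c, b) = (if c = a then u $$ (a, b) else 0)"
        proof cases
          case 3
          then show ?thesis using less.hyps[of c] less.prems by simp
        next
          case 4
          then show ?thesis using x0[OF True] less.prems by simp
        qed (use x u less.prems c in \<open>auto simp: pattern_group_carrier_iff\<close>)
      qed
      also have "\<dots> = u $$ (a, b)" using less.prems by simp
      finally show ?thesis by simp
    qed
  qed
  then show ?thesis
    using u by (intro eq_matI) (auto simp: pattern_group_carrier_iff nat_neq_iff)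
qed

text \<open>
  Clearing all entries of a matrix of the pattern group of \<open>T\<close> itself leaves the identity, so
  the elimination writes the matrix as a product of elementary ones.
\<close>

lemma pattern_group_subset_generated:
  fixes H :: "'a::{field, finite} mat set"
  assumes S: "S \<subseteq> \<Delta> n" "trans S" and T: "T \<subseteq> S" "trans T"
    and H: "subgroup H (pattern_group n S)"
    and elem: "\<And>a c t. (a, c) \<in> T \<Longrightarrow> elem_mat n a c t \<in> H"
  shows "carrier (pattern_group n T) \<subseteq> H"
proof
  let ?S = "pattern_group n S :: 'a mat monoid" and ?T = "pattern_group n T :: 'a mat monoid"
  interpret GT: group ?T by (rule group_pattern_group[OF T(2)])
  have Tn: "T \<subseteq> \<Delta> n" using S T by blast
  have HT: "subgroup (H \<inter> carrier ?T) ?S"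
    by (rule group.subgroups_Inter_pair[OF group_pattern_group[OF S(2)] H
          subgroup_pattern_group[OF S(2) T(2,1)]])
  fix g assume g: "g \<in> carrier ?T"
  then have gS: "g \<in> carrier ?S" using pattern_group_carrier_mono[OF T(1)] by blast
  have elem': "elem_mat n a c t \<in> H \<inter> carrier ?T" if "(a, c) \<in> T" for a c t
    using elem[OF that] elem_mat_in_carrier[OF Tn that] by blast
  obtain h where h: "h \<in> H \<inter> carrier ?T"
      and h0: "\<And>a c. (a, c) \<in> T \<Longrightarrow> (g * h) $$ (a - 1, c - 1) = 0"
    using clear_entries[OF S T(1) HT elem' gS] by blast
  have gh: "g * h \<in> carrier ?T" using GT.m_closed[OF g] h by simp
  have "1\<^sub>m n * (g * h) = g * h" by (rule left_mult_one_mat[OF pattern_group_carrier_mat[OF gh]])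
  then have "g * h = 1\<^sub>m n"
    using vanishing_multiplier_eq_one[OF GT.one_closed gh Tn] h0 Tn
    by (fastforce simp: \<Delta>_def)
  then have "inv\<^bsub>?S\<^esub> h = g"
    using gS h subgroup.subset[OF H]
    by (intro group.inv_equality[OF group_pattern_group[OF S(2)]]) auto
  then show "g \<in> H" using subgroup.m_inv_closed[OF H] h by blast
qed

text \<open>
  The generators at covering relations yield those at all positions of the transitive closure,
  since \<open>e\<^bsub>i,k\<^esub>(t)\<close> is the commutator of \<open>e\<^bsub>i,j\<^esub>(t)\<close> and \<open>e\<^bsub>j,k\<^esub>(1)\<close>.
\<close>

lemma pattern_subgroup_eq:
  assumes S: "S \<subseteq> \<Delta> n" "trans S"
  shows "(pattern_subgroup n S ij :: 'a::{field, finite} mat set) =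
    carrier (pattern_group n ((covering_relations S - {ij})\<^sup>+))"
proof
  let ?S = "pattern_group n S :: 'a mat monoid" and ?I = "covering_relations S - {ij}"
  let ?U = "pattern_subgroup n S ij :: 'a mat set"
  have I: "?I \<subseteq> S" by (auto simp: covering_relations_def)
  then have T: "?I\<^sup>+ \<subseteq> S" using S(2) by (metis trancl_id trancl_mono_subset)
  show "?U \<subseteq> carrier (pattern_group n (?I\<^sup>+))"
    unfolding pattern_subgroup_def
  proof (rule group.generate_subgroup_incl[OF group_pattern_group[OF S(2)]])
    show "{elem_mat n k l \<alpha> |k l \<alpha>. (k, l) \<in> ?I} \<subseteq> carrier (pattern_group n (?I\<^sup>+))"
      using elem_mat_in_carrier[OF order_trans[OF T S(1)]] by blast
  qed (rule subgroup_pattern_group[OF S(2) trans_trancl T])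
  have U: "subgroup ?U ?S" by (rule subgroup_pattern_subgroup[OF S])
  have gen: "elem_mat n k l t \<in> ?U" if "(k, l) \<in> ?I" for k l t
    unfolding pattern_subgroup_def using that by (intro generate.incl) blast
  have "elem_mat n a c t \<in> ?U" if "(a, c) \<in> ?I\<^sup>+" for a c t
    using that
  proof (induction arbitrary: t rule: trancl_induct)
    case (base c)
    then show ?case by (rule gen)
  next
    case (step b c)
    have "(a, b) \<in> \<Delta> n" "(b, c) \<in> \<Delta> n" using step I T S by blast+
    from elem_mat_commutator[OF this, of t 1]
    show ?case
      using subgroup.m_closed[OF U subgroup.m_closed[OF U subgroup.m_closed[OF U
            step.IH[of t] gen[OF step.hyps(2), of 1]] step.IH[of "- t"]]
            gen[OF step.hyps(2), of "- 1"]] by simp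
  qed
  then show "carrier (pattern_group n (?I\<^sup>+)) \<subseteq> ?U"
    by (rule pattern_group_subset_generated[OF S T trans_trancl U])
qed

section \<open>Fixed points of a field automorphism on cosets\<close>

text \<open>
  The fixed point is the normal form of the coset, its unique element that vanishes at all
  positions of \<open>T\<close>: its image under \<open>F\<close> is again an element of this kind.
\<close>

lemma stable_coset_has_fixed_point:
  fixes F :: "'a::{field, finite} \<Rightarrow> 'a"
  assumes F: "field_isom F" and S: "S \<subseteq> \<Delta> n" "trans S" and T: "T \<subseteq> S" "trans T"
    and g: "g \<in> carrier (pattern_group n S)"
    and stable: "map_mat F ` (g <#\<^bsub>pattern_group n S\<^esub> carrier (pattern_group n T)) =
      g <#\<^bsub>pattern_group n S\<^esub> carrier (pattern_group n T)"
  obtains x where "x \<in> g <#\<^bsub>pattern_group n S\<^esub> carrier (pattern_group n T)" "map_mat F x = x"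
proof -
  let ?S = "pattern_group n S :: 'a mat monoid" and ?T = "pattern_group n T :: 'a mat monoid"
  interpret field_isom F by (rule F)
  interpret GS: group ?S by (rule group_pattern_group[OF S(2)])
  have Tn: "T \<subseteq> \<Delta> n" using S T by blast
  have sub: "subgroup (carrier ?T) ?S" by (rule subgroup_pattern_group[OF S(2) T(2,1)])
  obtain h where h: "h \<in> carrier ?T"
      and h0: "\<And>a c. (a, c) \<in> T \<Longrightarrow> (g * h) $$ (a - 1, c - 1) = 0"
    using clear_entries[OF S T(1) sub elem_mat_in_carrier[OF Tn] g] by blast
  let ?x = "g * h"
  let ?C = "g <#\<^bsub>?S\<^esub> carrier ?T"
  have xC: "?x \<in> ?C" using h by (auto simp: l_coset_def)
  have x: "?x \<in> carrier ?S"
    using GS.m_closed[OF g] h subgroup.subset[OF sub] by auto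
  have "?C = ?x <#\<^bsub>?S\<^esub> carrier ?T" by (rule GS.l_repr_independence[OF xC g sub])
  moreover have "map_mat F ?x \<in> ?C" using xC stable by blast
  ultimately obtain u where u: "u \<in> carrier ?T" "map_mat F ?x = ?x * u"
    by (auto simp: l_coset_def)
  have "(?x * u) $$ (a - 1, c - 1) = 0" if "(a, c) \<in> T" for a c
  proof -
    have "a - 1 < n" "c - 1 < n" using that Tn by (auto simp: \<Delta>_def)
    then show ?thesis
      using h0[OF that] pattern_group_carrier_mat[OF g] pattern_group_carrier_mat[OF h]
      by (simp flip: u(2))
  qed
  from vanishing_multiplier_eq_one[OF x u(1) Tn h0 this] have "u = 1\<^sub>m n" by blast
  then have "map_mat F ?x = ?x" 
    using u(2) right_mult_one_mat[OF pattern_group_carrier_mat[OF x]] by simp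
  then show ?thesis using that xC by blast
qed

section \<open>Rational points of fixed cosets\<close>

text \<open>
  Here \<open>\<sigma>\<close> embeds a finite field onto the fixed field of \<open>F\<close>. Matrices in the image of \<open>\<sigma>\<close>
  are called rational.
\<close>

context
  fixes F :: "'a::{field, finite} \<Rightarrow> 'a" and \<sigma> :: "'k::{field, finite} \<Rightarrow> 'a"
    and n :: nat and S :: "(nat \<times> nat) set"
  assumes F: "field_isom F" and \<sigma>: "field_hom \<sigma>" and range_\<sigma>: "range \<sigma> = {x. F x = x}"
    and S: "S \<subseteq> \<Delta> n" "trans S"
begin

interpretation F: field_isom F by (rule F)
interpretation \<sigma>: field_hom \<sigma> by (rule \<sigma>)

abbreviation (input) "Ga \<equiv> pattern_group n S :: 'a mat monoid"
abbreviation (input) "Gk \<equiv> pattern_group n S :: 'k mat monoid"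
abbreviation (input) "Ua \<equiv> pattern_subgroup n S :: nat \<times> nat \<Rightarrow> 'a mat set"
abbreviation (input) "Uk \<equiv> pattern_subgroup n S :: nat \<times> nat \<Rightarrow> 'k mat set"

interpretation Ga: group Ga by (rule group_pattern_group[OF S(2)])
interpretation Gk: group Gk by (rule group_pattern_group[OF S(2)])

lemma map_mat_in_pattern_group_iff:
  "map_mat \<sigma> x \<in> carrier (pattern_group n T) \<longleftrightarrow> x \<in> carrier (pattern_group n T)"
proof (cases "x \<in> carrier_mat n n")
  case True
  then show ?thesis by (auto simp: pattern_group_carrier_iff)
qed (simp add: pattern_group_carrier_iff)

lemma map_mat_in_pattern_subgroup_iff: "map_mat \<sigma> x \<in> Ua i \<longleftrightarrow> x \<in> Uk i"
  by (simp only: pattern_subgroup_eq[OF S] map_mat_in_pattern_group_iff)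

lemma map_mat_fixed_iff: "map_mat F x = x \<longleftrightarrow> x \<in> range (map_mat \<sigma>)"
proof
  assume "map_mat F x = x"
  then have fixed: "F (x $$ (a, b)) = x $$ (a, b)" if "a < dim_row x" "b < dim_col x" for a b
    using that by (metis index_map_mat(1))
  have "x = map_mat \<sigma> (map_mat (inv_into UNIV \<sigma>) x)"
  proof (rule eq_matI)
    fix a b assume "a < dim_row (map_mat \<sigma> (map_mat (inv_into UNIV \<sigma>) x))"
      "b < dim_col (map_mat \<sigma> (map_mat (inv_into UNIV \<sigma>) x))"
    then have ab: "a < dim_row x" "b < dim_col x" by auto
    then have "x $$ (a, b) \<in> range \<sigma>" using fixed range_\<sigma> by auto
    then show "x $$ (a, b) = map_mat \<sigma> (map_mat (inv_into UNIV \<sigma>) x) $$ (a, b)"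
      using ab by (simp add: f_inv_into_f)
  qed auto
  then show "x \<in> range (map_mat \<sigma>)" by blast
next
  assume "x \<in> range (map_mat \<sigma>)"
  then obtain y where x: "x = map_mat \<sigma> y" by blast
  have "F (\<sigma> t) = \<sigma> t" for t using range_\<sigma> by blast
  then show "map_mat F x = x" unfolding x by (intro eq_matI) auto
qed

lemma map_mat_mult:
  assumes "x \<in> carrier Gk" "y \<in> carrier Gk"
  shows "map_mat \<sigma> (x * y) = map_mat \<sigma> x * map_mat \<sigma> y"
  using \<sigma>.mat_hom_mult pattern_group_carrier_mat[OF assms(1)] pattern_group_carrier_mat[OF assms(2)]
  by blast

text \<open>
  If \<open>\<sigma>(z) = \<sigma>(y) v\<close>, then \<open>v = \<sigma>(y\<inverse> z)\<close> is rational, and being in \<open>U\<^sub>i\<close> means the same for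
  \<open>y\<inverse> z\<close> as for \<open>v\<close> because it only concerns which entries are zero.
\<close>

lemma rational_points_of_coset:
  assumes y: "y \<in> carrier Gk"
  shows "map_mat \<sigma> -` (map_mat \<sigma> y <#\<^bsub>Ga\<^esub> Ua i) = y <#\<^bsub>Gk\<^esub> Uk i"
proof (rule Set.set_eqI)
  fix z
  have Uak: "Ua i \<subseteq> carrier Ga" "Uk i \<subseteq> carrier Gk"
    using subgroup.subset[OF subgroup_pattern_subgroup[OF S]] by blast+
  have \<sigma>y: "map_mat \<sigma> y \<in> carrier Ga" using y by (simp add: map_mat_in_pattern_group_iff)
  show "z \<in> map_mat \<sigma> -` (map_mat \<sigma> y <#\<^bsub>Ga\<^esub> Ua i) \<longleftrightarrow> z \<in> y <#\<^bsub>Gk\<^esub> Uk i"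
  proof
    assume "z \<in> y <#\<^bsub>Gk\<^esub> Uk i"
    then obtain u where u: "u \<in> Uk i" "z = y * u" by (auto simp: l_coset_def)
    then have "map_mat \<sigma> z = map_mat \<sigma> y * map_mat \<sigma> u" using map_mat_mult[OF y] Uak by blast
    moreover have "map_mat \<sigma> u \<in> Ua i" using u(1) map_mat_in_pattern_subgroup_iff by blast
    ultimately show "z \<in> map_mat \<sigma> -` (map_mat \<sigma> y <#\<^bsub>Ga\<^esub> Ua i)"
      by (auto simp: l_coset_def)
  next
    assume "z \<in> map_mat \<sigma> -` (map_mat \<sigma> y <#\<^bsub>Ga\<^esub> Ua i)"
    then obtain v where v: "v \<in> Ua i" "map_mat \<sigma> z = map_mat \<sigma> y * v" by (auto simp: l_coset_def)
    then have "map_mat \<sigma> z \<in> carrier Ga" using Ga.m_closed[OF \<sigma>y] Uak by auto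
    then have z: "z \<in> carrier Gk" by (simp add: map_mat_in_pattern_group_iff)
    define w where "w = inv\<^bsub>Gk\<^esub> y \<otimes>\<^bsub>Gk\<^esub> z"
    have w: "w \<in> carrier Gk" and zw: "z = y * w"
      unfolding w_def using y z Gk.m_assoc[of y "inv\<^bsub>Gk\<^esub> y" z] Gk.r_inv[OF y] Gk.l_one[OF z]
        Gk.m_closed[OF Gk.inv_closed[OF y] z] Gk.inv_closed[OF y] by auto
    have "map_mat \<sigma> y \<otimes>\<^bsub>Ga\<^esub> map_mat \<sigma> w = map_mat \<sigma> y \<otimes>\<^bsub>Ga\<^esub> v"
      using v zw map_mat_mult[OF y w] by simp
    then have "map_mat \<sigma> w = v"
      using \<sigma>y v(1) w Uak
      by (subst (asm) Ga.Units_l_cancel) (auto simp: Ga.Units_eq map_mat_in_pattern_group_iff)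
    then have "w \<in> Uk i" using v(1) map_mat_in_pattern_subgroup_iff by blast
    then show "z \<in> y <#\<^bsub>Gk\<^esub> Uk i" using zw by (auto simp: l_coset_def)
  qed
qed

text \<open>
  Two cosets that meet in \<open>w\<close> are \<open>w U\<^sub>i\<close> and \<open>w U\<^sub>j\<close>, and their intersection \<open>w (U\<^sub>i \<inter> U\<^sub>j)\<close> is
  a stable coset of a pattern group. The case \<open>i = j\<close>, \<open>g = h\<close> provides rational
  representatives of the fixed cosets.
\<close>

lemma fixed_cosets_common_rational_point:
  assumes g: "g \<in> carrier Ga" and h: "h \<in> carrier Ga"
    and Fg: "map_mat F ` (g <#\<^bsub>Ga\<^esub> Ua i) = g <#\<^bsub>Ga\<^esub> Ua i"
    and Fh: "map_mat F ` (h <#\<^bsub>Ga\<^esub> Ua j) = h <#\<^bsub>Ga\<^esub> Ua j"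
    and meet: "(g <#\<^bsub>Ga\<^esub> Ua i) \<inter> (h <#\<^bsub>Ga\<^esub> Ua j) \<noteq> {}"
  obtains y where "y \<in> carrier Gk" "map_mat \<sigma> y \<in> g <#\<^bsub>Ga\<^esub> Ua i" "map_mat \<sigma> y \<in> h <#\<^bsub>Ga\<^esub> Ua j"
proof -
  let ?T = "\<lambda>i. (covering_relations S - {i})\<^sup>+"
  have T: "?T i \<subseteq> S" for i
  proof -
    have "covering_relations S - {i} \<subseteq> S" by (auto simp: covering_relations_def)
    then show ?thesis using S(2) by (metis trancl_id trancl_mono_subset)
  qed
  have U: "subgroup (Ua i) Ga" for i by (rule subgroup_pattern_subgroup[OF S])
  obtain w where w: "w \<in> g <#\<^bsub>Ga\<^esub> Ua i" "w \<in> h <#\<^bsub>Ga\<^esub> Ua j" using meet by blast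
  have wG: "w \<in> carrier Ga"
    using w(1) Ga.l_coset_subset_G[OF subgroup.subset[OF U] g] by blast
  have reps: "g <#\<^bsub>Ga\<^esub> Ua i = w <#\<^bsub>Ga\<^esub> Ua i" "h <#\<^bsub>Ga\<^esub> Ua j = w <#\<^bsub>Ga\<^esub> Ua j"
    using Ga.l_repr_independence[OF w(1) g U] Ga.l_repr_independence[OF w(2) h U] by auto
  let ?C = "w <#\<^bsub>Ga\<^esub> carrier (pattern_group n (?T i \<inter> ?T j))"
  have inter: "(w <#\<^bsub>Ga\<^esub> Ua i) \<inter> (w <#\<^bsub>Ga\<^esub> Ua j) = ?C"
  proof -
    have "(w <#\<^bsub>Ga\<^esub> Ua i) \<inter> (w <#\<^bsub>Ga\<^esub> Ua j) = w <#\<^bsub>Ga\<^esub> (Ua i \<inter> Ua j)"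
    proof
      show "(w <#\<^bsub>Ga\<^esub> Ua i) \<inter> (w <#\<^bsub>Ga\<^esub> Ua j) \<subseteq> w <#\<^bsub>Ga\<^esub> (Ua i \<inter> Ua j)"
      proof
        fix z assume "z \<in> (w <#\<^bsub>Ga\<^esub> Ua i) \<inter> (w <#\<^bsub>Ga\<^esub> Ua j)"
        then obtain u v where uv: "u \<in> Ua i" "v \<in> Ua j" "z = w \<otimes>\<^bsub>Ga\<^esub> u" "z = w \<otimes>\<^bsub>Ga\<^esub> v"
          unfolding l_coset_def by blast
        then have "u = v"
          using Ga.Units_l_cancel[unfolded Ga.Units_eq, OF wG]
            subgroup.mem_carrier[OF U uv(1)] subgroup.mem_carrier[OF U uv(2)]
          by metis
        then show "z \<in> w <#\<^bsub>Ga\<^esub> (Ua i \<inter> Ua j)" using uv unfolding l_coset_def by blast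
      qed
    qed (auto simp: l_coset_def)
    then show ?thesis by (simp only: pattern_subgroup_eq[OF S] pattern_group_carrier_Int)
  qed
  have "map_mat F ` ?C = ?C"
    unfolding inter[symmetric] using Fg Fh
    by (simp add: image_Int[OF inj_map_mat[OF F S]] reps)
  then obtain x where x: "x \<in> ?C" "map_mat F x = x"
    by (rule stable_coset_has_fixed_point[OF F S le_infI1[OF T]
          trans_Int[OF trans_trancl trans_trancl] wG])
  have xG: "x \<in> carrier Ga"
    using x(1) Ga.l_coset_subset_G[OF subgroup.subset[OF U] wG] unfolding inter[symmetric] by blast
  obtain y where "x = map_mat \<sigma> y" using x(2) map_mat_fixed_iff by blast
  then show ?thesis
    using that[of y] x(1) xG unfolding inter[symmetric] reps
    by (auto simp: map_mat_in_pattern_group_iff)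
qed

text \<open>
  A fixed coset is recovered from its rational points: it contains one by the preceding
  lemma, and a single element determines a coset. The isomorphism takes preimages under \<open>\<sigma>\<close>
  rather than images, so that no representatives have to be chosen.
\<close>

lemma isomorphic_fixed_points_rational_points:
  "isomorphic (fixed_point_system (pattern_coset_system n S) (field_action F))
    (pattern_coset_system n S :: (nat \<times> nat, (nat \<times> nat) \<times> 'k mat set) incidence_system)"
proof -
  let ?I = "covering_relations S"
  define X where "X = {(i, g <#\<^bsub>Ga\<^esub> Ua i) |i g. i \<in> ?I \<and> g \<in> carrier Ga \<and>
    map_mat F ` (g <#\<^bsub>Ga\<^esub> Ua i) = g <#\<^bsub>Ga\<^esub> Ua i}"
  define Y where "Y = {(i, y <#\<^bsub>Gk\<^esub> Uk i) |i y. i \<in> ?I \<and> y \<in> carrier Gk}"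
  define f where "f = (\<lambda>(i :: nat \<times> nat, C). (i, map_mat \<sigma> -` C))"
  have U: "subgroup (Ua i) Ga" for i by (rule subgroup_pattern_subgroup[OF S])
  have self: "map_mat \<sigma> y \<in> map_mat \<sigma> y <#\<^bsub>Ga\<^esub> Ua i" if "y \<in> carrier Gk" for y i
    by (rule Ga.l_coset_self[OF _ U]) (use that in \<open>simp add: map_mat_in_pattern_group_iff\<close>)
  have rep: "\<exists>i y. i \<in> ?I \<and> y \<in> carrier Gk \<and> x = (i, map_mat \<sigma> y <#\<^bsub>Ga\<^esub> Ua i)"
    if xX: "x \<in> X" for x
  proof -
    obtain i g where x: "x = (i, g <#\<^bsub>Ga\<^esub> Ua i)" "i \<in> ?I" and g: "g \<in> carrier Ga"
      and Fg: "map_mat F ` (g <#\<^bsub>Ga\<^esub> Ua i) = g <#\<^bsub>Ga\<^esub> Ua i"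
      using xX unfolding X_def by blast
    have "(g <#\<^bsub>Ga\<^esub> Ua i) \<inter> (g <#\<^bsub>Ga\<^esub> Ua i) \<noteq> {}"
      using Ga.l_coset_self[OF g U] by blast
    then obtain y where "y \<in> carrier Gk" "map_mat \<sigma> y \<in> g <#\<^bsub>Ga\<^esub> Ua i"
      using fixed_cosets_common_rational_point[OF g g Fg Fg] by blast
    then show ?thesis using x Ga.l_repr_independence[OF _ g U] by blast
  qed
  have X_I: "(i, map_mat \<sigma> y <#\<^bsub>Ga\<^esub> Ua i) \<in> X" if "i \<in> ?I" "y \<in> carrier Gk" for i y
  proof -
    have \<sigma>y: "map_mat \<sigma> y \<in> carrier Ga" using that(2) by (simp add: map_mat_in_pattern_group_iff)
    have "map_mat F (map_mat \<sigma> y) = map_mat \<sigma> y" using map_mat_fixed_iff by blast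
    then have "map_mat F ` (map_mat \<sigma> y <#\<^bsub>Ga\<^esub> Ua i) = map_mat \<sigma> y <#\<^bsub>Ga\<^esub> Ua i"
      using map_mat_coset[OF F S \<sigma>y] by metis
    then show ?thesis unfolding X_def using that(1) \<sigma>y by blast
  qed
  have f_rep: "f (i, map_mat \<sigma> y <#\<^bsub>Ga\<^esub> Ua i) = (i, y <#\<^bsub>Gk\<^esub> Uk i)" if "y \<in> carrier Gk" for i y
    unfolding f_def using rational_points_of_coset[OF that] by simp
  have inj: "inj_on f X"
  proof (rule inj_onI)
    fix x x' assume xX: "x \<in> X" "x' \<in> X" and eq: "f x = f x'"
    obtain i y where x: "y \<in> carrier Gk" "x = (i, map_mat \<sigma> y <#\<^bsub>Ga\<^esub> Ua i)"
      using rep[OF xX(1)] by blast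
    obtain j z where x': "z \<in> carrier Gk" "x' = (j, map_mat \<sigma> z <#\<^bsub>Ga\<^esub> Ua j)"
      using rep[OF xX(2)] by blast
    have ij: "i = j" using eq by (simp add: f_def x x')
    have "map_mat \<sigma> y \<in> map_mat \<sigma> z <#\<^bsub>Ga\<^esub> Ua i"
      using eq self[OF x(1), of i] by (auto simp: f_def x x' ij)
    then show "x = x'"
      using Ga.l_repr_independence[OF _ _ U] x' x ij
      by (metis map_mat_in_pattern_group_iff)
  qed
  have img: "f ` X = Y"
  proof
    show "f ` X \<subseteq> Y"
    proof
      fix v assume "v \<in> f ` X"
      then obtain i y where "i \<in> ?I" "y \<in> carrier Gk" "v = f (i, map_mat \<sigma> y <#\<^bsub>Ga\<^esub> Ua i)"
        using rep by blast
      then show "v \<in> Y" unfolding Y_def by (auto simp only: f_rep)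
    qed
    show "Y \<subseteq> f ` X"
    proof
      fix v assume "v \<in> Y"
      then obtain i y where "i \<in> ?I" "y \<in> carrier Gk" "v = (i, y <#\<^bsub>Gk\<^esub> Uk i)"
        unfolding Y_def by blast
      then show "v \<in> f ` X" using X_I[of i y] f_rep[of y i] by (metis image_eqI)
    qed
  qed
  have inc: "map_mat \<sigma> -` C \<inter> map_mat \<sigma> -` D \<noteq> {} \<longleftrightarrow> C \<inter> D \<noteq> {}"
    if CD: "(i, C) \<in> X" "(j, D) \<in> X" for i j C D
  proof
    assume meet: "C \<inter> D \<noteq> {}"
    obtain g where g: "g \<in> carrier Ga" "map_mat F ` C = C" and C: "C = g <#\<^bsub>Ga\<^esub> Ua i"
      using CD(1) unfolding X_def by auto
    obtain h where h: "h \<in> carrier Ga" "map_mat F ` D = D" and D: "D = h <#\<^bsub>Ga\<^esub> Ua j"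
      using CD(2) unfolding X_def by auto
    obtain y where "map_mat \<sigma> y \<in> C" "map_mat \<sigma> y \<in> D"
      using fixed_cosets_common_rational_point[OF g(1) h(1)] g(2) h(2) meet unfolding C D by blast
    then show "map_mat \<sigma> -` C \<inter> map_mat \<sigma> -` D \<noteq> {}" by blast
  qed blast
  let ?A = "fixed_point_system (pattern_coset_system n S) (field_action F) ::
    (nat \<times> nat, (nat \<times> nat) \<times> 'a mat set) incidence_system"
  let ?B = "pattern_coset_system n S ::
    (nat \<times> nat, (nat \<times> nat) \<times> 'k mat set) incidence_system"
  note sys = fixed_point_system_def pattern_coset_system_def coset_incidence_system_def
  have XY: "elems ?A = X" "elems ?B = Y"
    unfolding X_def Y_def sys field_action_def by auto
  have "is_iso ?A ?B f"
    unfolding is_iso_def XY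
  proof (intro conjI ballI)
    show "types ?A = types ?B" by (simp add: sys)
    show "bij_betw f X Y" using inj img by (simp add: bij_betw_def)
    show "type_of ?B (f x) = type_of ?A x" for x by (simp add: sys f_def split_beta)
    fix x y assume "x \<in> X" "y \<in> X"
    then show "incident ?B (f x) (f y) \<longleftrightarrow> incident ?A x y"
      using inc[of "fst x" "snd x" "fst y" "snd y"] by (simp add: sys f_def split_beta)
  qed
  then show ?thesis unfolding isomorphic_def by blast
qed

end

section \<open>The prime field as fixed field\<close>

lemma CHAR_eq_of_card_prime_power:
  assumes "prime p" "card (UNIV :: 'a::finite_field set) = p ^ m"
  shows "CHAR('a) = p"
proof -
  have "prime CHAR('a)" using prime_CHAR_semidom[where 'a = 'a] CHAR_pos by blast
  moreover have "CHAR('a) dvd p ^ m" using CHAR_dvd_CARD[where 'a = 'a] assms(2) by simp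
  ultimately show ?thesis using assms(1) by (metis prime_dvd_power primes_dvd_imp_eq)
qed

text \<open>
  A field with \<open>p\<close> elements consists of the multiples \<open>of_nat k\<close> of \<open>1\<close>, as does the prime field
  of any field of the same characteristic. Every field automorphism fixes these \<open>p\<close>
  elements, so they exhaust a fixed field of order \<open>p\<close>.
\<close>

lemma prime_field_embedding_onto_fixed_field:
  fixes F :: "'q::finite_field \<Rightarrow> 'q"
  assumes p: "prime p" and cq: "card (UNIV :: 'q set) = p ^ m"
    and cp: "card (UNIV :: 'p::finite_field set) = p"
    and F: "field_isom F" and cF: "card {x. F x = x} = p"
  obtains \<sigma> :: "'p::finite_field \<Rightarrow> 'q" where "field_hom \<sigma>" "range \<sigma> = {x. F x = x}"
proof -
  interpret F: field_isom F by (rule F)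
  have char_p: "CHAR('p) = p" using CHAR_eq_of_card_prime_power[OF p, where m = 1] cp by simp
  have char_q: "CHAR('q) = p" by (rule CHAR_eq_of_card_prime_power[OF p cq])
  have eq_p: "(of_nat a :: 'p) = of_nat b \<longleftrightarrow> [a = b] (mod p)" for a b
    by (simp add: of_nat_eq_iff_cong_CHAR char_p)
  have eq_q: "(of_nat a :: 'q) = of_nat b \<longleftrightarrow> [a = b] (mod p)" for a b
    by (simp add: of_nat_eq_iff_cong_CHAR char_q)
  have "inj_on (of_nat :: nat \<Rightarrow> 'p) {..<p}" by (rule inj_onI) (simp add: eq_p cong_def)
  then have "card ((of_nat :: nat \<Rightarrow> 'p) ` {..<p}) = card (UNIV :: 'p set)"
    by (simp add: card_image cp)
  then have "(of_nat :: nat \<Rightarrow> 'p) ` {..<p} = UNIV" by (intro card_subset_eq) auto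
  then have "surj (of_nat :: nat \<Rightarrow> 'p)" by blast
  define \<sigma> :: "'p \<Rightarrow> 'q" where "\<sigma> x = of_nat (inv_into UNIV of_nat x)" for x
  have \<sigma>: "\<sigma> (of_nat a) = of_nat a" for a
  proof -
    have "(of_nat (inv_into UNIV of_nat (of_nat a :: 'p)) :: 'p) = of_nat a"
      by (rule surj_f_inv_f) fact
    then show ?thesis unfolding \<sigma>_def eq_p eq_q .
  qed
  have hom: "field_hom \<sigma>"
  proof
    show "\<sigma> 0 = 0" using \<sigma>[of 0] by simp
    show "\<sigma> 1 = 1" using \<sigma>[of 1] by simp
    fix x y :: 'p
    obtain a b where "x = of_nat a" "y = of_nat b" using \<open>surj of_nat\<close> by (metis surjD)
    then show "\<sigma> (x + y) = \<sigma> x + \<sigma> y" "\<sigma> (x * y) = \<sigma> x * \<sigma> y"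
      using \<sigma>[of "a + b"] \<sigma>[of "a * b"] by (simp_all add: \<sigma>)
  qed
  interpret \<sigma>: field_hom \<sigma> by (rule hom)
  have "F (of_nat a) = of_nat a" for a by (simp add: F.hom_of_nat)
  then have "range \<sigma> \<subseteq> {x. F x = x}" by (auto simp: \<sigma>_def)
  moreover have "card (range \<sigma>) = card {x. F x = x}"
    using card_image[OF \<sigma>.inj_f] cp cF by simp
  ultimately have "range \<sigma> = {x. F x = x}" by (intro card_subset_eq) auto
  then show ?thesis using that hom by blast
qed

theorem theorem5p2:
  fixes n p m :: nat
    and S :: "(nat \<times> nat) set"
    and F :: "'q::finite_field \<Rightarrow> 'q"
  assumes "n \<ge> 2"
    and "S \<subseteq> \<Delta> n" and "trans S"
    and "prime p" and "m > 1"
    and "card (UNIV :: 'q set) = p ^ m"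
    and "card (UNIV :: 'p::finite_field set) = p"
    and "field_isom F"
    and "card {x. F x = x} = p"
  shows "isomorphic
           (fixed_point_system (pattern_coset_system n S) (field_action F))
           (pattern_coset_system n S ::
              (nat \<times> nat, (nat \<times> nat) \<times> 'p mat set) incidence_system)"
proof -
  obtain \<sigma> :: "'p \<Rightarrow> 'q" where "field_hom \<sigma>" "range \<sigma> = {x. F x = x}"
    by (rule prime_field_embedding_onto_fixed_field[OF assms(4,6,7,8,9)])
  then show ?thesis
    by (rule isomorphic_fixed_points_rational_points[OF assms(8) _ _ assms(2,3)])
qed

end
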